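(* Let $X$ be an irreducible shift space over a finite alphabet. Then $X$ is synchronized and bi-balanced if and only if $X$ has variable specification.
   Context: Let $\mathcal A$ be a finite alphabet. A shift space $X\subset\mathcal A^{\mathbb Z}$ is a nonempty closed set invariant under the left shift $\sigma$ (i.e. $\sigma(X)=X$). $\mathcal B_n(X)$ is the set of words of length $n$ occurring in points of $X$, with $\mathcal B_0(X)=\{\varepsilon\}$ ($\varepsilon$ the empty word), and $\mathcal B(X)=\bigcup_{n\ge 0}\mathcal B_n(X)$. $X$ is irreducible if for every ordered pair $u,v\in\mathcal B(X)$ there is $w\in\mathcal B(X)$ with $uwv\in\mathcal B(X)$; such a $w$ is called a bridge from $u$ to $v$. For $u\in\mathcal B(X)$ and $n\ge 0$, let $\mathcal F_n(u,X)=\{w\in\mathcal B_n(X): uw\in\mathcal B(X)\}$ and $\mathcal P_n(u,X)=\{w\in\mathcal B_n(X): wu\in\mathcal B(X)\}$. $X$ is right-balanced if there is $c>0$ such that $|\mathcal F_n(u,X)|/|\mathcal B_n(X)|\ge c$ for all $u\in\mathcal B(X)$ and $n\ge 1$; left-balanced if there is $c>0$ such that $|\mathcal P_n(u,X)|/|\mathcal B_n(X)|\ge c$ for all $u\in\mathcal B(X)$ and $n\ge1$; bi-balanced if it is both right- and left-balanced. A word $w\in\mathcal B(X)$ is synchronizing if whenever $uw\in\mathcal B(X)$ and $wv\in\mathcal B(X)$ we have $uwv\in\mathcal B(X)$. An irreducible shift space with a synchronizing word is called synchronized. $X$ has variable specification if there is $N\ge 0$ such that for all $u,v\in\mathcal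 B(X)$ there is a word $w\in\mathcal B(X)$ of length at most $N$ with $uwv\in\mathcal B(X)$. *)

theory Defs
  imports "HOL-Analysis.Function_Topology"
begin

definition shift :: "(int \<Rightarrow> 'a) \<Rightarrow> (int \<Rightarrow> 'a)" where
  "shift x = (\<lambda>i. x (i + 1))"

text \<open>Closedness is taken in the product over \<open>\<int>\<close> of the discrete topologies on the alphabet
  \<open>A\<close>. Its underlying set consists of all functions from \<open>int\<close> into \<open>A\<close>, so \<^const>\<open>closedin\<close> also
  forces the points of \<open>X\<close> to take values in \<open>A\<close>.\<close>

definition shift_space :: "'a set \<Rightarrow> (int \<Rightarrow> 'a) set \<Rightarrow> bool" where
  "shift_space A X \<longleftrightarrow>
     X \<noteq> {} \<and>
     closedin (product_topology (\<lambda>_. discrete_topology A) (UNIV :: int set)) X \<and>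
     shift ` X = X"

definition subword :: "(int \<Rightarrow> 'a) \<Rightarrow> int \<Rightarrow> nat \<Rightarrow> 'a list" where
  "subword x i n = map (\<lambda>k. x (i + int k)) [0..<n]"

definition blocks :: "nat \<Rightarrow> (int \<Rightarrow> 'a) set \<Rightarrow> 'a list set" where
  "blocks n X = {subword x i n | x i. x \<in> X}"

text \<open>The convention that the only block of length 0 is the empty word needs no separate clause.\<close>

lemma blocks_0: "X \<noteq> {} \<Longrightarrow> blocks 0 X = {[]}"
  by (auto simp: blocks_def subword_def)

definition language :: "(int \<Rightarrow> 'a) set \<Rightarrow> 'a list set" where
  "language X = (\<Union>n. blocks n X)"

definition irreducible_shift :: "(int \<Rightarrow> 'a) set \<Rightarrow> bool" where
  "irreducible_shift X \<longleftrightarrow>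
     (\<forall>u \<in> language X. \<forall>v \<in> language X. \<exists>w \<in> language X. u @ w @ v \<in> language X)"

definition followers :: "nat \<Rightarrow> 'a list \<Rightarrow> (int \<Rightarrow> 'a) set \<Rightarrow> 'a list set" where
  "followers n u X = {w \<in> blocks n X. u @ w \<in> language X}"

definition predecessors :: "nat \<Rightarrow> 'a list \<Rightarrow> (int \<Rightarrow> 'a) set \<Rightarrow> 'a list set" where
  "predecessors n u X = {w \<in> blocks n X. w @ u \<in> language X}"

definition right_balanced :: "(int \<Rightarrow> 'a) set \<Rightarrow> bool" where
  "right_balanced X \<longleftrightarrow>
     (\<exists>c::real. c > 0 \<and>
        (\<forall>u \<in> language X. \<forall>n \<ge> 1. real (card (followers n u X)) / real (card (blocks n X)) \<ge> c))"

definition left_balanced :: "(int \<Rightarrow> 'a) set \<Rightarrow> bool" where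
  "left_balanced X \<longleftrightarrow>
     (\<exists>c::real. c > 0 \<and>
        (\<forall>u \<in> language X. \<forall>n \<ge> 1. real (card (predecessors n u X)) / real (card (blocks n X)) \<ge> c))"

definition bi_balanced :: "(int \<Rightarrow> 'a) set \<Rightarrow> bool" where
  "bi_balanced X \<longleftrightarrow> right_balanced X \<and> left_balanced X"

definition synchronizing :: "'a list \<Rightarrow> (int \<Rightarrow> 'a) set \<Rightarrow> bool" where
  "synchronizing w X \<longleftrightarrow>
     w \<in> language X \<and>
     (\<forall>u v. u @ w \<in> language X \<longrightarrow> w @ v \<in> language X \<longrightarrow> u @ w @ v \<in> language X)"

definition synchronized :: "(int \<Rightarrow> 'a) set \<Rightarrow> bool" where
  "synchronized X \<longleftrightarrow> irreducible_shift X \<and> (\<exists>w. synchronizing w X)"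

definition variable_specification :: "(int \<Rightarrow> 'a) set \<Rightarrow> bool" where
  "variable_specification X \<longleftrightarrow>
     (\<exists>N::nat. \<forall>u \<in> language X. \<forall>v \<in> language X.
        \<exists>w \<in> language X. length w \<le> N \<and> u @ w @ v \<in> language X)"

end

theory Submission
  imports Defs
begin

text \<open>Everything happens in the language \<open>L\<close> of \<open>X\<close>, and left-handed notions are the right-handed ones of
  the reversed language. Write \<open>B n\<close> for the number of words of length \<open>n\<close> and let \<open>s\<close> be synchronizing.

  Let \<open>G n\<close> be the set of words of length \<open>n\<close> in which \<open>s\<close> occurs only as a suffix. Decomposing words
  at the first occurrence of \<open>s\<close>, right balance yields that \<open>\<Sum>n. card (G n) / B n\<close> converges;
  dually, left balance yields this for the words \<open>E n\<close> in which \<open>s\<close> occurs only as a prefix.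
  Suppose \<open>s\<close> cannot be reached from \<open>u\<close> within \<open>M\<close> letters. Extending \<open>u\<close> to the left and cutting at
  the last occurrence of \<open>s\<close>, one may take \<open>u = s v\<close> with no further occurrence of \<open>s\<close>. A positive
  fraction of all words of a large length \<open>k\<close> follow \<open>u\<close>. Those avoiding \<open>s\<close> extend \<open>u\<close> to an element of
  \<open>E (length u + k)\<close> and so form a vanishing fraction; the others start with an element of \<open>G n\<close>
  for some \<open>n > M\<close>, so their fraction is bounded by a tail of the convergent series. Hence \<open>M\<close> is
  bounded, and bridges through \<open>s\<close> have bounded length.\<close>

section \<open>Words, reversal and occurrences of a fixed word\<close>

definition level :: "'a list set \<Rightarrow> nat \<Rightarrow> 'a list set" where
  "level L n = {w \<in> L. length w = n}"

definition right_balanced_language :: "'a list set \<Rightarrow> bool" where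
  "right_balanced_language L \<longleftrightarrow>
     (\<exists>c::real. c > 0 \<and>
        (\<forall>u \<in> L. \<forall>n \<ge> 1. c * card (level L n) \<le> card {w \<in> level L n. u @ w \<in> L}))"

text \<open>Taken over all \<open>n\<close>, these words form a prefix code: none is a proper prefix
  of another, so a word has at most one such prefix.\<close>

definition first_hits :: "'a list set \<Rightarrow> 'a list \<Rightarrow> nat \<Rightarrow> 'a list set" where
  "first_hits L s n =
     {w \<in> level L n. (\<exists>y. w = y @ s) \<and> (\<forall>x y. w = x @ s @ y \<longrightarrow> y = [])}"

lemma mem_rev_image_iff: "u \<in> rev ` L \<longleftrightarrow> rev u \<in> L"
  by (metis (no_types, lifting) image_iff rev_rev_ident)

lemma level_rev: "level (rev ` L) n = rev ` level L n"
  unfolding level_def by force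

lemma card_level_rev: "card (level (rev ` L) n) = card (level L n)"
  unfolding level_rev by (simp add: card_image inj_on_def)

lemma first_occurrence:
  assumes "q = x @ s @ y"
  obtains w t where "q = w @ t" "\<exists>v. w = v @ s" "\<forall>a b. w = a @ s @ b \<longrightarrow> b = []"
proof -
  define n where "n = (LEAST n. \<exists>x y. q = x @ s @ y \<and> length x = n)"
  have "\<exists>x y. q = x @ s @ y \<and> length x = n"
    unfolding n_def by (rule LeastI_ex) (use assms in blast)
  then obtain a b where ab: "q = a @ s @ b" "length a = n" by blast
  have least: "n \<le> length a'" if "q = a' @ s @ b'" for a' b'
    unfolding n_def by (rule Least_le) (use that in blast)
  show ?thesis
  proof (rule that[of "a @ s" b])
    show "\<forall>a' b'. a @ s = a' @ s @ b' \<longrightarrow> b' = []"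
    proof (intro allI impI)
      fix a' b' assume e: "a @ s = a' @ s @ b'"
      then have "q = a' @ s @ (b' @ b)" using ab by simp
      from least[OF this] have "length a \<le> length a'" using ab by simp
      moreover have "length a = length a' + length b'"
        using arg_cong[OF e, of length] by simp
      ultimately show "b' = []" by simp
    qed
  qed (use ab in auto)
qed

lemma last_occurrence:
  assumes "q = x @ s @ y"
  obtains v t where "q = t @ s @ v" "\<forall>a b. s @ v = a @ s @ b \<longrightarrow> a = []"
proof -
  have "rev q = rev y @ rev s @ rev x" using assms by simp
  then obtain w t where wt: "rev q = w @ t" "\<exists>v. w = v @ rev s"
    "\<forall>a b. w = a @ rev s @ b \<longrightarrow> b = []" by (rule first_occurrence)
  then obtain v where v: "w = v @ rev s" by blast
  show ?thesis
  proof (rule that[of "rev t" "rev v"])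
    show "q = rev t @ s @ rev v"
      using wt(1) v by (metis append.assoc rev_append rev_rev_ident)
    show "\<forall>a b. s @ rev v = a @ s @ b \<longrightarrow> a = []"
    proof (intro allI impI)
      fix a b assume "s @ rev v = a @ s @ b"
      then have "rev (s @ rev v) = rev (a @ s @ b)" by simp
      then have "w = rev b @ rev s @ rev a" using v by simp
      then show "a = []" using wt(3) by blast
    qed
  qed
qed

section \<open>Counting words in factorial languages\<close>

locale factorial_language =
  fixes L :: "'a list set"
  assumes factor: "x @ y @ z \<in> L \<Longrightarrow> y \<in> L"
    and finite_level: "finite (level L n)"
    and level_nonempty: "level L n \<noteq> {}"
begin

lemma prefix_mem: "x @ y \<in> L \<Longrightarrow> x \<in> L"
  using factor[of "[]" x y] by simp

lemma suffix_mem: "x @ y \<in> L \<Longrightarrow> y \<in> L"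
  using factor[of x y "[]"] by simp

lemma Nil_mem: "[] \<in> L"
  using level_nonempty[of 0] by (auto simp: level_def)

lemma card_level_pos: "card (level L n) > 0"
  using finite_level level_nonempty by (simp add: card_gt_0_iff)

lemma factorial_language_rev: "factorial_language (rev ` L)"
proof
  fix x y z :: "'a list" and n
  show "y \<in> rev ` L" if "x @ y @ z \<in> rev ` L"
    using that factor[of "rev z" "rev y" "rev x"] by (simp add: mem_rev_image_iff)
  show "finite (level (rev ` L) n)" "level (rev ` L) n \<noteq> {}"
    using finite_level level_nonempty by (simp_all add: level_rev)
qed

lemma card_level_add: "card (level L (m + n)) \<le> card (level L m) * card (level L n)"
proof -
  have "level L (m + n) \<subseteq> (\<lambda>(a, b). a @ b) ` (level L m \<times> level L n)"
  proof
    fix w assume w: "w \<in> level L (m + n)"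
    then have "take m w \<in> level L m" "drop m w \<in> level L n"
      using prefix_mem[of "take m w" "drop m w"] suffix_mem[of "take m w" "drop m w"]
      by (auto simp: level_def)
    then show "w \<in> (\<lambda>(a, b). a @ b) ` (level L m \<times> level L n)"
      by (intro image_eqI[of _ _ "(take m w, drop m w)"]) auto
  qed
  then have "card (level L (m + n)) \<le> card (level L m \<times> level L n)"
    by (rule surj_card_le[rotated]) (simp add: finite_level)
  then show ?thesis by (simp add: card_cartesian_product)
qed

text \<open>Extends the bound to \<open>n = 0\<close>, where every word of the level follows
  \<open>u\<close> and any constant at most 1 works; hence \<open>min c 1\<close>.\<close>

lemma right_balanced_languageE:
  assumes "right_balanced_language L"
  obtains c :: real where "0 < c"
    "\<And>u n. u \<in> L \<Longrightarrow> c * card (level L n) \<le> card {w \<in> level L n. u @ w \<in> L}"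
proof -
  obtain c :: real where c: "c > 0"
    "\<And>u n. u \<in> L \<Longrightarrow> n \<ge> 1 \<Longrightarrow> c * card (level L n) \<le> card {w \<in> level L n. u @ w \<in> L}"
    using assms unfolding right_balanced_language_def by blast
  show ?thesis
  proof (rule that[of "min c 1"])
    fix u n assume u: "u \<in> L"
    show "min c 1 * card (level L n) \<le> card {w \<in> level L n. u @ w \<in> L}"
    proof (cases "n = 0")
      case True
      then have "{w \<in> level L n. u @ w \<in> L} = level L n"
        using u by (auto simp: level_def)
      then show ?thesis
        using mult_right_mono[of "min c 1" 1 "real (card (level L n))"] by simp
    next
      case False
      have "min c 1 * card (level L n) \<le> c * card (level L n)"
        by (intro mult_right_mono) auto
      then show ?thesis using c(2)[OF u, of n] False by linarith
    qed
  qed (use c in auto)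
qed

text \<open>Each word of length \<open>m\<close> has at least \<open>c * card (level L n)\<close>
  continuations, and a word of length \<open>m + n\<close> splits in only one way. Together with
  \<open>card_level_add\<close>, word counts are multiplicative up to the factor
  \<open>c\<close>.\<close>

lemma card_level_mult_le:
  fixes c :: real
  assumes "0 < c" "\<And>u n. u \<in> L \<Longrightarrow> c * card (level L n) \<le> card {w \<in> level L n. u @ w \<in> L}"
  shows "c * (card (level L m) * card (level L n)) \<le> real (card (level L (m + n)))"
proof -
  define S where "S = Sigma (level L m) (\<lambda>w. {t \<in> level L n. w @ t \<in> L})"
  have "c * (card (level L m) * card (level L n)) = (\<Sum>w\<in>level L m. c * real (card (level L n)))"
    by simp
  also have "\<dots> \<le> (\<Sum>w\<in>level L m. real (card {t \<in> level L n. w @ t \<in> L}))"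
    by (intro sum_mono assms(2)) (simp add: level_def)
  also have "\<dots> = real (card S)"
    unfolding S_def by (subst card_SigmaI) (auto simp: finite_level)
  also have "card S = card ((\<lambda>(w, t). w @ t) ` S)"
    by (rule card_image[symmetric]) (auto simp: inj_on_def S_def level_def)
  also have "real \<dots> \<le> card (level L (m + n))"
    by (intro of_nat_mono card_mono finite_level) (auto simp: S_def level_def)
  finally show ?thesis .
qed

text \<open>A first hit of length \<open>n \<le> k\<close> has at least
  \<open>c * card (level L (k - n))\<close> continuations of total length \<open>k\<close>, which by
  submultiplicativity is a fraction of at least \<open>c / card (level L n)\<close> of all words of
  length \<open>k\<close>. By the prefix code property these families are disjoint, so each partial
  sum is at most \<open>1 / c\<close>.\<close>

lemma summable_first_hits:
  assumes "right_balanced_language L"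
  shows "summable (\<lambda>n. card (first_hits L s n) / card (level L n))"
proof -
  obtain c :: real where c: "0 < c"
    "\<And>u n. u \<in> L \<Longrightarrow> c * card (level L n) \<le> card {w \<in> level L n. u @ w \<in> L}"
    by (rule right_balanced_languageE[OF assms]) blast
  have fin: "finite (first_hits L s n)" for n
    by (rule finite_subset[OF _ finite_level[of n]]) (auto simp: first_hits_def)
  have bound: "(\<Sum>n\<le>k. card (first_hits L s n) / card (level L n)) \<le> 1 / c" for k
  proof -
    define T where "T n = Sigma (first_hits L s n) (\<lambda>w. {t \<in> level L (k - n). w @ t \<in> L})" for n
    define S where "S = Sigma {..k} T"
    have finT: "finite (T n)" for n
      unfolding T_def by (intro finite_SigmaI fin) (simp add: finite_level)
    have inj: "inj_on (\<lambda>(n, w, t). w @ t) S"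
    proof -
      \<comment> \<open>The prefix code property: the occurrence of \<open>s\<close> that ends
        \<open>w\<close> would be a non-final one in \<open>w @ d\<close>.\<close>
      have no_extension: "d = []" if hits: "w \<in> first_hits L s n" "w @ d \<in> first_hits L s n'" for w d n n'
      proof -
        obtain y where "w = y @ s" using hits(1) by (auto simp: first_hits_def)
        then have "w @ d = y @ s @ d" by simp
        then show ?thesis using hits(2) unfolding first_hits_def by blast
      qed
      have eq: "w = w'"
        if hits: "w \<in> first_hits L s n" "w' \<in> first_hits L s n'" "w @ t = w' @ t'"
        for w w' n n' t t'
      proof -
        consider d where "w' = w @ d" | d where "w = w' @ d"
          using hits(3) by (auto simp: append_eq_append_conv2)
        then show ?thesis using no_extension hits(1,2) by cases auto
      qed
      show ?thesis
      proof (rule inj_onI)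
        fix p p' assume pS: "p \<in> S" "p' \<in> S" "(\<lambda>(n, w, t). w @ t) p = (\<lambda>(n, w, t). w @ t) p'"
        obtain n w t n' w' t' where p: "p = (n, w, t)" "p' = (n', w', t')"
          by (metis prod_cases3)
        have a: "(n, w, t) \<in> S" "(n', w', t') \<in> S" "w @ t = w' @ t'"
          using pS by (simp_all add: p)
        then have "w = w'" using eq[of w n w' n'] by (auto simp: S_def T_def)
        then show "p = p'"
          using a by (auto simp: p S_def T_def first_hits_def level_def)
      qed
    qed
    have "c * (\<Sum>n\<le>k. card (first_hits L s n) / card (level L n)) * card (level L k)
        = (\<Sum>n\<le>k. c * card (first_hits L s n) * (card (level L k) / card (level L n)))"
      by (simp add: sum_distrib_left sum_distrib_right algebra_simps)
    also have "\<dots> \<le> (\<Sum>n\<le>k. real (card (T n)))"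
    proof (rule sum_mono)
      fix n assume "n \<in> {..k}"
      then have "real (card (level L k)) \<le> card (level L n) * card (level L (k - n))"
        using card_level_add[of n "k - n"] by (simp flip: of_nat_mult)
      then have "card (level L k) / card (level L n) \<le> card (level L (k - n))"
        using card_level_pos[of n] by (simp add: field_simps)
      then have "c * card (first_hits L s n) * (card (level L k) / card (level L n))
          \<le> c * card (first_hits L s n) * card (level L (k - n))"
        using c(1) by (intro mult_left_mono) auto
      also have "\<dots> = (\<Sum>w\<in>first_hits L s n. c * real (card (level L (k - n))))" by simp
      also have "\<dots> \<le> (\<Sum>w\<in>first_hits L s n. real (card {t \<in> level L (k - n). w @ t \<in> L}))"
        by (intro sum_mono c(2)) (auto simp: first_hits_def level_def)
      also have "\<dots> = real (card (T n))"
        unfolding T_def by (subst card_SigmaI) (auto simp: finite_level fin)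
      finally show "c * card (first_hits L s n) * (card (level L k) / card (level L n))
          \<le> card (T n)" .
    qed
    also have "\<dots> = real (card S)"
      unfolding S_def by (subst card_SigmaI) (auto simp: finT)
    also have "card S = card ((\<lambda>(n, w, t). w @ t) ` S)"
      by (rule card_image[OF inj, symmetric])
    also have "\<dots> \<le> card (level L k)"
      by (rule card_mono[OF finite_level]) (auto simp: S_def T_def level_def first_hits_def)
    finally have "c * (\<Sum>n\<le>k. card (first_hits L s n) / card (level L n)) * real (card (level L k))
        \<le> 1 * real (card (level L k))" by simp
    then have "c * (\<Sum>n\<le>k. card (first_hits L s n) / card (level L n)) \<le> 1"
      using card_level_pos[of k] by (simp only: mult_le_cancel_right_pos of_nat_0_less_iff)
    then show ?thesis using c(1) by (simp add: field_simps)
  qed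
  show ?thesis
    by (rule bounded_imp_summable) (use bound in auto)
qed

section \<open>Reaching the synchronizing word in bounded time\<close>

text \<open>The form \<open>x @ u @ p = z @ s\<close> lets the occurrence of \<open>s\<close>
  overlap \<open>u\<close>, so \<open>p\<close> may be shorter than \<open>s\<close>. The left
  context \<open>x\<close> is what allows \<open>u\<close> to be replaced by a word starting with
  \<open>s\<close>.\<close>

lemma bounded_hitting:
  assumes s: "s \<in> L"
    and sync: "\<And>u v. u @ s \<in> L \<Longrightarrow> s @ v \<in> L \<Longrightarrow> u @ s @ v \<in> L"
    and irreducible: "\<And>u v. u \<in> L \<Longrightarrow> v \<in> L \<Longrightarrow> \<exists>w. u @ w @ v \<in> L"
    and right: "right_balanced_language L"
    and left: "right_balanced_language (rev ` L)"
  shows "\<exists>M. \<forall>u\<in>L. \<exists>x p z. length p \<le> M \<and> x @ u @ p = z @ s \<and> z @ s \<in> L"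
proof -
  interpret R: factorial_language "rev ` L"
    by (rule factorial_language_rev)
  obtain c :: real where c: "0 < c"
    "\<And>u n. u \<in> L \<Longrightarrow> c * card (level L n) \<le> card {w \<in> level L n. u @ w \<in> L}"
    by (rule right_balanced_languageE[OF right]) blast
  define B where "B n = real (card (level L n))" for n
  have B: "0 < B n" "B (m + n) \<le> B m * B n" "c * (B m * B n) \<le> B (m + n)" for m n
    unfolding B_def using card_level_pos card_level_add[of m n] card_level_mult_le[OF c, of m n]
    by (simp_all flip: of_nat_mult)
  define G where "G = first_hits L s"
  \<comment> \<open>The mirror image of \<open>G\<close>; reversal turns it into first hits of
    \<open>rev s\<close>, so the summability lemma applies to it as well.\<close>
  define E where
    "E n = {w \<in> level L n. (\<exists>y. w = s @ y) \<and> (\<forall>x y. w = x @ s @ y \<longrightarrow> x = [])}" for n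
  have fin_G: "finite (G n)" and fin_E: "finite (E n)" for n
    by (rule finite_subset[OF _ finite_level[of n]]; auto simp: G_def E_def first_hits_def)+
  have card_E: "card (E n) = card (first_hits (rev ` L) (rev s) n)" for n
  proof (rule bij_betw_same_card[of rev], rule bij_betw_byWitness[of _ rev])
    have "rev w \<in> first_hits (rev ` L) (rev s) n" if "w \<in> E n" for w
    proof -
      have "y = []" if "rev w = x @ rev s @ y" for x y
      proof -
        have "w = rev y @ s @ rev x"
          using arg_cong[OF that, of rev] by simp
        then show ?thesis using \<open>w \<in> E n\<close> by (auto simp: E_def)
      qed
      then show ?thesis
        using that by (auto simp: E_def first_hits_def level_def)
    qed
    then show "rev ` E n \<subseteq> first_hits (rev ` L) (rev s) n" by blast
    have "rev w \<in> E n" if "w \<in> first_hits (rev ` L) (rev s) n" for w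
    proof -
      have "x = []" if "rev w = x @ s @ y" for x y
      proof -
        have "w = rev y @ rev s @ rev x"
          using arg_cong[OF that, of rev] by simp
        then show ?thesis
          using \<open>w \<in> first_hits (rev ` L) (rev s) n\<close> by (auto simp: first_hits_def)
      qed
      moreover have "rev w \<in> level L n" "\<exists>y. rev w = s @ y"
        using that by (auto simp: first_hits_def level_def mem_rev_image_iff)
      ultimately show ?thesis unfolding E_def by blast
    qed
    then show "rev ` first_hits (rev ` L) (rev s) n \<subseteq> E n" by blast
  qed auto
  have "summable (\<lambda>n. card (G n) / B n)"
    unfolding G_def B_def by (rule summable_first_hits[OF right])
  \<comment> \<open>One factor \<open>c\<close> of the threshold is lost below in
    \<open>B (k - n) \<le> B k / (c * B n)\<close>, which leaves \<open>c / 2\<close>.\<close>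
  then obtain M0 where M0: "\<And>m k. m \<ge> M0 \<Longrightarrow> norm (\<Sum>n\<in>{m..<k}. card (G n) / B n) < c\<^sup>2 / 2"
    using c(1) unfolding summable_Cauchy by (meson half_gt_zero zero_less_power)
  \<comment> \<open>Being at least \<open>length s\<close>, this \<open>M\<close> ensures that an
    occurrence of \<open>s\<close> ending more than \<open>M\<close> letters after
    \<open>s @ v\<close> starts after \<open>s @ v\<close>.\<close>
  define M where "M = max M0 (length s)"
  have tail: "(\<Sum>n\<in>{M..<k}. card (G n) / B n) < c\<^sup>2 / 2" for k
    using M0[of M k] by (simp add: M_def)
  have E_lim: "(\<lambda>n. card (E n) / B n) \<longlonglongrightarrow> 0"
    unfolding card_E B_def using summable_LIMSEQ_zero[OF R.summable_first_hits[OF left]]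
    by (simp add: card_level_rev)
  have "\<exists>x p z. length p \<le> M \<and> x @ u @ p = z @ s \<and> z @ s \<in> L" if u: "u \<in> L" for u
  proof (rule ccontr)
    assume bad: "\<nexists>x p z. length p \<le> M \<and> x @ u @ p = z @ s \<and> z @ s \<in> L"
    \<comment> \<open>Irreducibility puts some \<open>s\<close> to the left of \<open>u\<close>, so
      that a last occurrence exists.\<close>
    obtain a where a: "s @ a @ u \<in> L" using irreducible[OF s u] by blast
    have "s @ a @ u = [] @ s @ (a @ u)" by simp
    then obtain v t where vt: "s @ a @ u = t @ s @ v"
      and last: "\<And>a b. s @ v = a @ s @ b \<Longrightarrow> a = []"
      by (rule last_occurrence) blast
    have ts: "t @ s \<in> L" and sv: "s @ v \<in> L"
      using a vt prefix_mem[of "t @ s" v] suffix_mem[of t "s @ v"] by simp_all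
    \<comment> \<open>Synchronization glues \<open>t @ s\<close> in front of any continuation of
      \<open>s @ v\<close>. A short return of \<open>s @ v\<close> to \<open>s\<close> would thus be
      a short hit for \<open>u\<close> with left context \<open>s @ a\<close>, against
      \<open>bad\<close>.\<close>
    have long: "length q > M" if q: "s @ v @ q \<in> L" "s @ v @ q = z @ s" for q z
    proof (rule ccontr)
      assume "\<not> length q > M"
      then have "length q \<le> M" by simp
      moreover have "(s @ a) @ u @ q = (t @ z) @ s"
        using arg_cong[OF vt, of "\<lambda>w. w @ q"] q(2) by simp
      moreover have "(t @ z) @ s \<in> L"
        using sync[OF ts q(1)] q(2) by simp
      ultimately show False using bad by blast
    qed
    define m where "m = length (s @ v)"
    \<comment> \<open>The length \<open>m\<close> is fixed before \<open>k\<close> is chosen, so the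
      threshold may depend on \<open>B m\<close>; submultiplicativity then turns the bound into
      \<open>c / 2 * B k\<close>.\<close>
    have "0 < c / (2 * B m)" using c(1) B(1) by simp
    from order_tendstoD(2)[OF E_lim this] obtain k where
      "card (E (m + k)) / B (m + k) < c / (2 * B m)"
      unfolding eventually_sequentially using le_add2 by blast
    then have "card (E (m + k)) < c / (2 * B m) * B (m + k)"
      using B(1) by (simp add: field_simps)
    also have "\<dots> \<le> c / (2 * B m) * (B m * B k)"
      using c(1) B(1)[of m] B(2) by (intro mult_left_mono) auto
    also have "\<dots> = c / 2 * B k" using B(1)[of m] by simp
    finally have card_E_less: "card (E (m + k)) < c / 2 * B k" .
    define F1 where "F1 = {q \<in> level L k. s @ v @ q \<in> E (m + k)}"
    define T where "T = Sigma {M..<Suc k} (\<lambda>n. G n \<times> level L (k - n))"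
    have fin_T: "finite T"
      unfolding T_def by (intro finite_SigmaI finite_cartesian_product fin_G finite_level) auto
    \<comment> \<open>A continuation without \<open>s\<close> lands in \<open>F1\<close>; any other
      is cut after its first hit, which is longer than \<open>M\<close> by
      \<open>long\<close>.\<close>
    have "{q \<in> level L k. (s @ v) @ q \<in> L} \<subseteq> F1 \<union> (\<lambda>(n, w, t). w @ t) ` T"
    proof
      fix q assume q: "q \<in> {q \<in> level L k. (s @ v) @ q \<in> L}"
      then have qL: "q \<in> L" "length q = k" "s @ v @ q \<in> L" by (auto simp: level_def)
      show "q \<in> F1 \<union> (\<lambda>(n, w, t). w @ t) ` T"
      proof (cases "\<exists>x y. q = x @ s @ y")
        case True
        then obtain x y where "q = x @ s @ y" by blast
        then obtain w t where wt: "q = w @ t" "\<exists>v. w = v @ s" "\<forall>a b. w = a @ s @ b \<longrightarrow> b = []"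
          by (rule first_occurrence)
        then obtain v' where v': "w = v' @ s" by blast
        have "w \<in> L" "t \<in> L" using qL(1) wt(1) prefix_mem[of w t] suffix_mem[of w t] by auto
        moreover have "length w > M"
          by (rule long[of _ "s @ v @ v'"]) (use qL(3) wt(1) v' prefix_mem[of "s @ v @ w" t] in auto)
        ultimately have "(length w, w, t) \<in> T"
          using wt qL(2) by (auto simp: T_def G_def first_hits_def level_def)
        then show ?thesis
          using wt(1) by (intro UnI2 image_eqI[of _ _ "(length w, w, t)"]) auto
      next
        case False
        \<comment> \<open>An occurrence inside \<open>s @ v\<close> is the initial one by
          \<open>last\<close>. One that ends inside \<open>q\<close> ends more than
          \<open>length s\<close> letters into it by \<open>long\<close>, hence lies in
          \<open>q\<close>, which is excluded in this case.\<close>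
        have "x = []" if eq: "s @ v @ q = x @ s @ y" for x y
        proof -
          have "(s @ v) @ q = (x @ s) @ y" using eq by simp
          then obtain d where "s @ v = (x @ s) @ d \<or> (s @ v) @ d = x @ s \<and> q = d @ y"
            using append_eq_append_conv2[of "s @ v" q "x @ s" y] by blast
          then consider "s @ v = x @ s @ d" | "s @ v @ d = x @ s" "q = d @ y"
            by force
          then show ?thesis
          proof cases
            case 1
            then show ?thesis by (rule last)
          next
            case 2
            have "s @ v @ d \<in> L" using qL(3) 2(2) prefix_mem[of "s @ v @ d" y] by simp
            from long[OF this 2(1)] have len: "length d > length s" by (simp add: M_def)
            have "(s @ v) @ d = x @ s" using 2(1) by simp
            then obtain d' where "d' @ d = s \<or> d = d' @ s"
              using append_eq_append_conv2[of "s @ v" d x s] by blast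
            then have "d = d' @ s" using len by auto
            then show ?thesis using False 2(2) by auto
          qed
        qed
        then show ?thesis
          using q by (auto simp: F1_def E_def level_def m_def)
      qed
    qed
    then have "card {q \<in> level L k. (s @ v) @ q \<in> L} \<le> card (F1 \<union> (\<lambda>(n, w, t). w @ t) ` T)"
      by (rule card_mono[rotated]) (auto simp: F1_def fin_T finite_level)
    also have "\<dots> \<le> card F1 + card ((\<lambda>(n, w, t). w @ t) ` T)" by (rule card_Un_le)
    also have "\<dots> \<le> card (E (m + k)) + card T"
    proof (rule add_mono)
      show "card F1 \<le> card (E (m + k))"
        by (rule card_inj_on_le[of "\<lambda>q. s @ v @ q"]) (auto simp: F1_def inj_on_def fin_E)
      show "card ((\<lambda>(n, w, t). w @ t) ` T) \<le> card T" by (rule card_image_le[OF fin_T])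
    qed
    finally have "c * B k \<le> real (card (E (m + k))) + real (card T)"
      using c(2)[OF sv, of k] unfolding B_def by linarith
    moreover have "real (card T) \<le> c / 2 * B k"
    proof -
      have "real (card T) = (\<Sum>n\<in>{M..<Suc k}. real (card (G n)) * B (k - n))"
        unfolding T_def B_def
        by (subst card_SigmaI) (auto simp: fin_G finite_level card_cartesian_product)
      also have "\<dots> \<le> (\<Sum>n\<in>{M..<Suc k}. card (G n) / B n * (B k / c))"
      proof (rule sum_mono)
        fix n assume "n \<in> {M..<Suc k}"
        then have "c * (B n * B (k - n)) \<le> B k" using B(3)[of n "k - n"] by simp
        then have "B (k - n) \<le> B k / (c * B n)" using c(1) B(1)[of n] by (simp add: field_simps)
        then have "card (G n) * B (k - n) \<le> card (G n) * (B k / (c * B n))"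
          by (rule mult_left_mono) simp
        then show "card (G n) * B (k - n) \<le> card (G n) / B n * (B k / c)"
          by (simp add: field_simps)
      qed
      also have "\<dots> = (\<Sum>n\<in>{M..<Suc k}. card (G n) / B n) * (B k / c)"
        by (rule sum_distrib_right[symmetric])
      also have "\<dots> \<le> c\<^sup>2 / 2 * (B k / c)"
        using tail[of "Suc k"] c(1) B(1)[of k] by (intro mult_right_mono) auto
      also have "\<dots> = c / 2 * B k" using c(1) by (simp add: power2_eq_square)
      finally show ?thesis .
    qed
    \<comment> \<open>The two classes fill less than \<open>c / 2 + c / 2\<close> of the level,
      whereas right balance demands \<open>c\<close>.\<close>
    ultimately show False using card_E_less by linarith
  qed
  then show ?thesis by blast
qed

text \<open>From \<open>u\<close> one reaches \<open>s\<close> within \<open>M\<close> letters, and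
  dually \<open>v\<close> is reached from \<open>s\<close> within \<open>M'\<close> letters. A fixed
  bridge \<open>r\<close> from \<open>s\<close> to \<open>s\<close> joins the two, giving
  \<open>N = M + length r + M'\<close>.\<close>

lemma synchronized_balanced_imp_specification:
  assumes s: "s \<in> L"
    and sync: "\<And>u v. u @ s \<in> L \<Longrightarrow> s @ v \<in> L \<Longrightarrow> u @ s @ v \<in> L"
    and irreducible: "\<And>u v. u \<in> L \<Longrightarrow> v \<in> L \<Longrightarrow> \<exists>w. u @ w @ v \<in> L"
    and right: "right_balanced_language L"
    and left: "right_balanced_language (rev ` L)"
  shows "\<exists>N. \<forall>u\<in>L. \<forall>v\<in>L. \<exists>w\<in>L. length w \<le> N \<and> u @ w @ v \<in> L"
proof -
  interpret R: factorial_language "rev ` L"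
    by (rule factorial_language_rev)
  obtain M where M: "\<forall>u\<in>L. \<exists>x p z. length p \<le> M \<and> x @ u @ p = z @ s \<and> z @ s \<in> L"
    using bounded_hitting[OF assms] by (rule exE)
  have "\<exists>M. \<forall>u\<in>rev ` L. \<exists>x p z. length p \<le> M \<and> x @ u @ p = z @ rev s \<and> z @ rev s \<in> rev ` L"
  proof (rule R.bounded_hitting)
    show "\<exists>w. u @ w @ v \<in> rev ` L" if "u \<in> rev ` L" "v \<in> rev ` L" for u v
    proof -
      obtain w where "rev v @ w @ rev u \<in> L"
        using irreducible[of "rev v" "rev u"] \<open>u \<in> rev ` L\<close> \<open>v \<in> rev ` L\<close>
        by (auto simp: mem_rev_image_iff)
      then have "u @ rev w @ v \<in> rev ` L" by (simp add: mem_rev_image_iff)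
      then show ?thesis by blast
    qed
    show "u @ rev s @ v \<in> rev ` L" if "u @ rev s \<in> rev ` L" "rev s @ v \<in> rev ` L" for u v
      using that sync[of "rev v" "rev u"] by (simp add: mem_rev_image_iff)
  qed (use s left right in \<open>simp_all add: image_image\<close>)
  then obtain M' where M': "\<forall>v\<in>rev ` L.
      \<exists>x p z. length p \<le> M' \<and> x @ v @ p = z @ rev s \<and> z @ rev s \<in> rev ` L"
    by (rule exE)
  obtain r where r: "s @ r @ s \<in> L" using irreducible[OF s s] by blast
  have "\<exists>w\<in>L. length w \<le> M + length r + M' \<and> u @ w @ v \<in> L" if u: "u \<in> L" and v: "v \<in> L" for u v
  proof -
    obtain x p z where p: "length p \<le> M" "x @ u @ p = z @ s" "z @ s \<in> L"
      using M u by blast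
    obtain x' p' z' where p': "length p' \<le> M'" "x' @ rev v @ p' = z' @ rev s"
        "z' @ rev s \<in> rev ` L"
      using M' v by blast
    have eq: "rev p' @ v @ rev x' = s @ rev z'"
      using arg_cong[OF p'(2), of rev] by simp
    have "s @ rev z' \<in> L" using p'(3) by (simp add: mem_rev_image_iff)
    \<comment> \<open>Synchronization is applied at each end of \<open>s @ r @ s\<close>; afterwards
      \<open>factor\<close> strips the contexts \<open>x\<close> and \<open>rev x'\<close>.\<close>
    moreover have "(z @ s @ r) @ s \<in> L" using sync[OF p(3), of "r @ s"] r by simp
    ultimately have "(z @ s @ r) @ s @ rev z' \<in> L" using sync[of "z @ s @ r" "rev z'"] by simp
    also have "(z @ s @ r) @ s @ rev z' = (z @ s) @ r @ (s @ rev z')" by simp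
    also have "\<dots> = (x @ u @ p) @ r @ (rev p' @ v @ rev x')" by (simp only: p(2) eq)
    also have "\<dots> = x @ (u @ (p @ r @ rev p') @ v) @ rev x'" by simp
    finally have "u @ (p @ r @ rev p') @ v \<in> L" by (rule factor)
    moreover from this have "p @ r @ rev p' \<in> L" by (rule factor)
    ultimately show ?thesis using p(1) p'(1) by (intro bexI[of _ "p @ r @ rev p'"]) auto
  qed
  then show ?thesis by blast
qed

section \<open>From variable specification to synchronization and balance\<close>

text \<open>Extending \<open>u\<close> to the left and \<open>v\<close> to the right can only shrink the set of bridges of bounded
  length. Once this set has minimal cardinality it no longer changes, so for every bridge \<open>w\<close> in it
  the word \<open>u @ w @ v\<close> is synchronizing.\<close>

lemma specification_imp_synchronizing:
  assumes spec: "\<And>u v. u \<in> L \<Longrightarrow> v \<in> L \<Longrightarrow> \<exists>w\<in>L. length w \<le> N \<and> u @ w @ v \<in> L"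
  shows "\<exists>s\<in>L. \<forall>u v. u @ s \<in> L \<longrightarrow> s @ v \<in> L \<longrightarrow> u @ s @ v \<in> L"
proof -
  define D where "D = (\<lambda>(u, v). {w \<in> L. length w \<le> N \<and> u @ w @ v \<in> L})"
  have "finite (\<Union>n\<le>N. level L n)" by (simp add: finite_level)
  then have fin: "finite (D p)" for p
    by (rule rev_finite_subset) (auto simp: D_def level_def split: prod.splits)
  have "([], []) \<in> L \<times> L" using Nil_mem by simp
  from ex_has_least_nat[of "\<lambda>p. p \<in> L \<times> L", OF this, of "\<lambda>p. card (D p)"]
  obtain u v where uv: "u \<in> L" "v \<in> L"
    and least: "\<And>u' v'. u' \<in> L \<Longrightarrow> v' \<in> L \<Longrightarrow> card (D (u, v)) \<le> card (D (u', v'))"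
    by auto
  obtain w where w: "w \<in> D (u, v)" using spec[OF uv] by (auto simp: D_def)
  have "a @ (u @ w @ v) @ b \<in> L" if "a @ (u @ w @ v) \<in> L" "(u @ w @ v) @ b \<in> L" for a b
  proof -
    have "a @ u \<in> L" "v @ b \<in> L"
      using that prefix_mem[of "a @ u" "w @ v"] suffix_mem[of "u @ w" "v @ b"] by simp_all
    moreover have "D (a @ u, v @ b) \<subseteq> D (u, v)"
      using factor[of a "u @ _ @ v" b] by (auto simp: D_def)
    ultimately have "D (a @ u, v @ b) = D (u, v)"
      by (intro card_seteq fin least)
    then show ?thesis using w by (auto simp: D_def)
  qed
  moreover have "u @ w @ v \<in> L" using w by (simp add: D_def)
  ultimately show ?thesis by blast
qed

text \<open>Putting a bridge \<open>p\<close> between \<open>u\<close> and a word \<open>w\<close>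
  of length \<open>n\<close> and cutting \<open>p @ w\<close> to length \<open>n\<close> gives a
  follower of \<open>u\<close>. The follower and the lost end of \<open>w\<close>, an element of
  \<open>K\<close>, determine \<open>w\<close>; hence the constant
  \<open>1 / card K\<close>.\<close>

lemma specification_imp_right_balanced:
  assumes spec: "\<And>u v. u \<in> L \<Longrightarrow> v \<in> L \<Longrightarrow> \<exists>w\<in>L. length w \<le> N \<and> u @ w @ v \<in> L"
  shows "right_balanced_language L"
proof -
  define K where "K = (\<Union>n\<le>N. level L n)"
  have fin_K: "finite K" by (simp add: K_def finite_level)
  moreover have "[] \<in> K" using Nil_mem by (auto simp: K_def level_def)
  ultimately have K_pos: "card K > 0" by (auto simp: card_gt_0_iff)
  have bound: "card (level L n) \<le> card {w \<in> level L n. u @ w \<in> L} * card K" if u: "u \<in> L" for u n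
  proof -
    define F where "F = {w \<in> level L n. u @ w \<in> L}"
    have "level L n \<subseteq> (\<lambda>(a, b). drop (length b) a @ b) ` (F \<times> K)"
    proof
      fix w assume "w \<in> level L n"
      then have w: "w \<in> L" "length w = n" by (auto simp: level_def)
      obtain p where p: "p \<in> L" "length p \<le> N" "u @ p @ w \<in> L" using spec[OF u w(1)] by blast
      \<comment> \<open>Here \<open>b\<close> is the part of \<open>w\<close> pushed out by
        \<open>p\<close>. If \<open>p\<close> is longer than \<open>n\<close>, truncated subtraction
        makes \<open>b\<close> all of \<open>w\<close>, and \<open>drop (length b) a\<close> is
        empty.\<close>
      define a b where "a = take n (p @ w)" and "b = drop (n - length p) w"
      have "u @ a \<in> L"
        using p(3) prefix_mem[of "u @ a" "drop n (p @ w)"] by (simp add: a_def del: take_append drop_append)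
      moreover from this have "a \<in> L" by (rule suffix_mem)
      moreover have "length a = n" using w(2) by (simp add: a_def)
      ultimately have "a \<in> F" by (simp add: F_def level_def)
      moreover have "b \<in> L"
        using w(1) suffix_mem[of "take (n - length p) w" b] by (simp add: b_def)
      then have "b \<in> K" using w(2) p(2) by (auto simp: K_def level_def b_def)
      moreover have "w = drop (length b) a @ b"
        using w(2) by (cases "length p \<le> n") (auto simp: a_def b_def)
      ultimately show "w \<in> (\<lambda>(a, b). drop (length b) a @ b) ` (F \<times> K)"
        by (intro image_eqI[of _ _ "(a, b)"]) auto
    qed
    then have "card (level L n) \<le> card (F \<times> K)"
      by (rule surj_card_le[rotated]) (simp add: F_def finite_level fin_K)
    then show ?thesis by (simp add: F_def card_cartesian_product)
  qed
  have "1 / card K * card (level L n) \<le> card {w \<in> level L n. u @ w \<in> L}" if "u \<in> L" for u n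
    using K_pos of_nat_mono[OF bound[OF that, of n], where 'a = real] by (simp add: field_simps)
  then show ?thesis
    unfolding right_balanced_language_def using K_pos by (intro exI[of _ "1 / card K"]) simp
qed

lemma specification_rev:
  assumes spec: "\<And>u v. u \<in> L \<Longrightarrow> v \<in> L \<Longrightarrow> \<exists>w\<in>L. length w \<le> N \<and> u @ w @ v \<in> L"
    and "u \<in> rev ` L" "v \<in> rev ` L"
  shows "\<exists>w\<in>rev ` L. length w \<le> N \<and> u @ w @ v \<in> rev ` L"
proof -
  obtain w where "w \<in> L" "length w \<le> N" "rev v @ w @ rev u \<in> L"
    using spec[of "rev v" "rev u"] assms(2,3) by (auto simp: mem_rev_image_iff)
  then show ?thesis by (intro bexI[of _ "rev w"]) (auto simp: mem_rev_image_iff)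
qed

end

section \<open>Transfer to shift spaces\<close>

lemma length_subword [simp]: "length (subword x i n) = n"
  by (simp add: subword_def)

lemma blocks_eq_level: "blocks n X = level (language X) n"
proof -
  have "length w = m" if "w \<in> blocks m X" for w m
    using that by (auto simp: blocks_def)
  moreover have "blocks n X \<subseteq> language X" by (auto simp: language_def)
  ultimately show ?thesis by (auto simp: level_def language_def)
qed

lemma subword_append_factor:
  assumes "a @ b @ c = subword x i n"
  shows "b = subword x (i + int (length a)) (length b)"
proof (rule nth_equalityI)
  fix j assume j: "j < length b"
  have "length (a @ b @ c) = n" using assms by simp
  then have "length a + j < n" using j by simp
  have "b ! j = (a @ b @ c) ! (length a + j)" using j by (simp add: nth_append)
  also have "\<dots> = x (i + int (length a + j))"
    unfolding assms using \<open>length a + j < n\<close> by (simp add: subword_def)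
  finally show "b ! j = subword x (i + int (length a)) (length b) ! j"
    using j by (simp add: subword_def algebra_simps)
qed simp

lemma factorial_language_shift_space:
  assumes "finite A" "shift_space A X"
  shows "factorial_language (language X)"
proof
  fix a b c :: "'a list" assume "a @ b @ c \<in> language X"
  then show "b \<in> language X"
    by (fastforce simp: language_def blocks_def dest: subword_append_factor)
next
  fix n
  have "X \<subseteq> (\<Pi>\<^sub>E i\<in>UNIV. A)"
    using assms(2) closedin_subset by (fastforce simp: shift_space_def)
  then have "blocks n X \<subseteq> {xs. set xs \<subseteq> A \<and> length xs = n}"
    by (fastforce simp: blocks_def subword_def PiE_def)
  then show "finite (level (language X) n)"
    unfolding blocks_eq_level by (rule finite_subset) (rule finite_lists_length_eq[OF assms(1)])
  show "level (language X) n \<noteq> {}"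
    using assms(2) by (auto simp: shift_space_def blocks_def simp flip: blocks_eq_level)
qed

lemma right_balanced_iff:
  assumes "factorial_language (language X)"
  shows "right_balanced X \<longleftrightarrow> right_balanced_language (language X)"
  unfolding right_balanced_def right_balanced_language_def followers_def blocks_eq_level
  using factorial_language.card_level_pos[OF assms] by (simp add: pos_le_divide_eq)

lemma left_balanced_iff:
  assumes "factorial_language (language X)"
  shows "left_balanced X \<longleftrightarrow> right_balanced_language (rev ` language X)"
proof -
  have "card {w \<in> level (rev ` L) n. rev u @ w \<in> rev ` L} = card {w \<in> level L n. w @ u \<in> L}"
    for L :: "'a list set" and u n
  proof -
    have "{w \<in> level (rev ` L) n. rev u @ w \<in> rev ` L} = rev ` {w \<in> level L n. w @ u \<in> L}"
      by (auto simp: level_rev mem_rev_image_iff)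
    then show ?thesis by (simp add: card_image inj_on_def)
  qed
  then show ?thesis
    unfolding left_balanced_def right_balanced_language_def predecessors_def blocks_eq_level
    using factorial_language.card_level_pos[OF assms]
    by (simp add: pos_le_divide_eq card_level_rev)
qed

theorem theorem1p1:
  fixes A :: "'a set" and X :: "(int \<Rightarrow> 'a) set"
  assumes "finite A"
    and "shift_space A X"
    and "irreducible_shift X"
  shows "synchronized X \<and> bi_balanced X \<longleftrightarrow> variable_specification X"
proof -
  interpret factorial_language "language X"
    by (rule factorial_language_shift_space[OF assms(1,2)])
  interpret R: factorial_language "rev ` language X"
    by (rule factorial_language_rev)
  note balanced = bi_balanced_def right_balanced_iff[OF factorial_language_axioms]
    left_balanced_iff[OF factorial_language_axioms]
  show ?thesis
  proof
    assume "synchronized X \<and> bi_balanced X"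
    then obtain s where s: "synchronizing s X"
      and bal: "right_balanced_language (language X)" "right_balanced_language (rev ` language X)"
      by (auto simp: synchronized_def balanced)
    show "variable_specification X"
      unfolding variable_specification_def
      by (rule synchronized_balanced_imp_specification[OF _ _ _ bal, of s])
        (use s assms(3) in \<open>auto simp: synchronizing_def irreducible_shift_def Bex_def, blast\<close>)
  next
    assume "variable_specification X"
    then obtain N where spec: "\<And>u v. u \<in> language X \<Longrightarrow> v \<in> language X \<Longrightarrow>
        \<exists>w\<in>language X. length w \<le> N \<and> u @ w @ v \<in> language X"
      unfolding variable_specification_def by blast
    have "synchronized X"
      using specification_imp_synchronizing[OF spec] assms(3)
      by (auto simp: synchronized_def synchronizing_def)
    moreover have "bi_balanced X"
      unfolding balanced using specification_imp_right_balanced[OF spec]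
        R.specification_imp_right_balanced[OF specification_rev[OF spec]] by blast
    ultimately show "synchronized X \<and> bi_balanced X" by blast
  qed
qed

end
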